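(* Let $E$ be an elliptic curve over $\mathbb{Q}$ such that $E(\mathbb{Q})[7]\neq\{0\}$. Assume moreover that the conductor of $E$ is $N_E=p^{\alpha}q^{\beta}$, where $p,q$ are distinct primes and $\alpha,\beta>0$ are integers. Then the minimal discriminant is $\Delta_E=-2^7\cdot 13$. In particular, $|\Delta_E|<N_E^3$, and Szpiro's conjecture holds for these curves: for every $\epsilon>0$ there is a constant $C_\epsilon$ such that $|\Delta_E|\le C_\epsilon N_E^{6+\epsilon}$ for every such $E$.
   Context: For an elliptic curve $E/\mathbb{Q}$, $\Delta_E$ denotes its minimal discriminant and $N_E$ its conductor. $E(\mathbb{Q})[7]$ is the subgroup of points of $E(\mathbb{Q})$ killed by multiplication by $7$. Szpiro's conjecture is the assertion that $|\Delta_E|\ll_{\epsilon}N_E^{6+\epsilon}$ for elliptic curves $E/\mathbb{Q}$. *)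

theory Defs
  imports
    "HOL-Algebra.Generated_Fields"
    "HOL-Algebra.Ideal_Product"
    "HOL-Algebra.QuotRing"
    "HOL-Computational_Algebra.Computational_Algebra"
    Complex_Main
begin

section \<open>Weierstrass curves\<close>

text \<open>
  The curve \<open>y\<^sup>2 + a1 x y + a3 y = x\<^sup>3 + a2 x\<^sup>2 + a4 x + a6\<close>.
\<close>

datatype 'a weierstrass = Weierstrass (a1: 'a) (a2: 'a) (a3: 'a) (a4: 'a) (a6: 'a)

definition b2 :: "'a::comm_ring_1 weierstrass \<Rightarrow> 'a" where
  "b2 W = (a1 W)^2 + 4 * a2 W"

definition b4 :: "'a::comm_ring_1 weierstrass \<Rightarrow> 'a" where
  "b4 W = 2 * a4 W + a1 W * a3 W"

definition b6 :: "'a::comm_ring_1 weierstrass \<Rightarrow> 'a" where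
  "b6 W = (a3 W)^2 + 4 * a6 W"

definition b8 :: "'a::comm_ring_1 weierstrass \<Rightarrow> 'a" where
  "b8 W = (a1 W)^2 * a6 W + 4 * a2 W * a6 W - a1 W * a3 W * a4 W
          + a2 W * (a3 W)^2 - (a4 W)^2"

definition discriminant :: "'a::comm_ring_1 weierstrass \<Rightarrow> 'a" where
  "discriminant W = - ((b2 W)^2 * b8 W) - 8 * (b4 W)^3 - 27 * (b6 W)^2
                    + 9 * b2 W * b4 W * b6 W"

definition elliptic_curve :: "'a::field weierstrass \<Rightarrow> bool" where
  "elliptic_curve E \<longleftrightarrow> discriminant E \<noteq> 0"

text \<open>
  \<open>change_of_variables u r s t W V\<close>: the curve \<open>V\<close> (in coordinates \<open>x', y'\<close>) arises from \<open>W\<close> by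
  \<open>x = u\<^sup>2 x' + r\<close>, \<open>y = u\<^sup>3 y' + u\<^sup>2 s x' + t\<close>.
\<close>

definition change_of_variables ::
    "'a::field \<Rightarrow> 'a \<Rightarrow> 'a \<Rightarrow> 'a \<Rightarrow> 'a weierstrass \<Rightarrow> 'a weierstrass \<Rightarrow> bool" where
  "change_of_variables u r s t W V \<longleftrightarrow> u \<noteq> 0 \<and>
     u * a1 V = a1 W + 2 * s \<and>
     u^2 * a2 V = a2 W - s * a1 W + 3 * r - s^2 \<and>
     u^3 * a3 V = a3 W + r * a1 W + 2 * t \<and>
     u^4 * a4 V = a4 W - s * a3 W + 2 * r * a2 W - (t + r * s) * a1 W + 3 * r^2 - 2 * s * t \<and>
     u^6 * a6 V = a6 W + r * a4 W + r^2 * a2 W + r^3 - t * a3 W - t^2 - r * t * a1 W"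

definition isomorphic :: "'a::field weierstrass \<Rightarrow> 'a weierstrass \<Rightarrow> bool" where
  "isomorphic W V \<longleftrightarrow> (\<exists>u r s t. change_of_variables u r s t W V)"


section \<open>Points and the group law\<close>

datatype 'a point = Infinity | Affine 'a 'a

fun on_curve :: "'a::field weierstrass \<Rightarrow> 'a point \<Rightarrow> bool" where
  "on_curve W Infinity \<longleftrightarrow> True"
| "on_curve W (Affine x y) \<longleftrightarrow>
     y^2 + a1 W * x * y + a3 W * y = x^3 + a2 W * x^2 + a4 W * x + a6 W"

text \<open>Chord and tangent addition; the first conditional is the case \<open>(x1, y1) = - (x2, y2)\<close>.\<close>

fun add_points :: "'a::field weierstrass \<Rightarrow> 'a point \<Rightarrow> 'a point \<Rightarrow> 'a point" where
  "add_points W Infinity Q = Q"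
| "add_points W (Affine x1 y1) Infinity = Affine x1 y1"
| "add_points W (Affine x1 y1) (Affine x2 y2) =
     (if x1 = x2 \<and> y1 + y2 + a1 W * x2 + a3 W = 0 then Infinity
      else
        let l = (if x1 = x2
                 then (3 * x1^2 + 2 * a2 W * x1 + a4 W - a1 W * y1) / (2 * y1 + a1 W * x1 + a3 W)
                 else (y2 - y1) / (x2 - x1));
            x3 = l^2 + a1 W * l - a2 W - x1 - x2
        in Affine x3 (- (l * (x3 - x1) + y1) - a1 W * x3 - a3 W))"

fun nsmul_point :: "'a::field weierstrass \<Rightarrow> nat \<Rightarrow> 'a point \<Rightarrow> 'a point" where
  "nsmul_point W 0 P = Infinity"
| "nsmul_point W (Suc n) P = add_points W P (nsmul_point W n P)"

definition torsion :: "'a::field weierstrass \<Rightarrow> nat \<Rightarrow> 'a point set" where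
  "torsion W n = {P. on_curve W P \<and> nsmul_point W n P = Infinity}"


section \<open>Minimal discriminant\<close>

definition integral_model :: "rat weierstrass \<Rightarrow> int weierstrass \<Rightarrow> bool" where
  "integral_model E M \<longleftrightarrow> isomorphic E (map_weierstrass rat_of_int M)"

text \<open>
  As \<open>\<int>\<close> has class number one, an integral model with the smallest absolute discriminant is a
  global minimal model, i.e.\ it is minimal at every prime. It is unique up to changes of
  variables with \<open>u = \<plusminus>1\<close> and integral \<open>r, s, t\<close>; these preserve the discriminant and the
  type of reduction at every prime.
\<close>

definition minimal_model :: "rat weierstrass \<Rightarrow> int weierstrass" where
  "minimal_model E = arg_min (\<lambda>M. nat \<bar>discriminant M\<bar>) (integral_model E)"

definition minimal_discriminant :: "rat weierstrass \<Rightarrow> int" where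
  "minimal_discriminant E = discriminant (minimal_model E)"


section \<open>Reduction types\<close>

text \<open>Bad reduction: the reduction modulo \<open>p\<close> of a minimal model is not an elliptic curve.\<close>

definition bad_reduction :: "rat weierstrass \<Rightarrow> nat \<Rightarrow> bool" where
  "bad_reduction E p \<longleftrightarrow> int p dvd minimal_discriminant E"

text \<open>
  \<open>(x, y)\<close> reduces modulo \<open>p\<close> to a singular point of the reduced curve: the equation and both
  partial derivatives vanish. Since \<open>\<bbbF>\<^sub>p\<close> is perfect, the unique singular point of a singular
  Weierstrass cubic is defined over \<open>\<bbbF>\<^sub>p\<close>, so integers suffice as coordinates.
\<close>

definition singular_mod :: "nat \<Rightarrow> int weierstrass \<Rightarrow> int \<Rightarrow> int \<Rightarrow> bool" where
  "singular_mod p M x y \<longleftrightarrow>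
     int p dvd y^2 + a1 M * x * y + a3 M * y - (x^3 + a2 M * x^2 + a4 M * x + a6 M) \<and>
     int p dvd a1 M * y - (3 * x^2 + 2 * a2 M * x + a4 M) \<and>
     int p dvd 2 * y + a1 M * x + a3 M"

text \<open>
  The tangent cone at a singular point \<open>(x, y)\<close> is \<open>Y\<^sup>2 + a1 X Y - (3 x + a2) X\<^sup>2\<close>. The point is a
  node iff the two tangents are distinct, i.e.\ iff the discriminant of this form is nonzero (in
  every characteristic), and a cusp otherwise.
\<close>

definition multiplicative_reduction :: "rat weierstrass \<Rightarrow> nat \<Rightarrow> bool" where
  "multiplicative_reduction E p \<longleftrightarrow> bad_reduction E p \<and>
     (let M = minimal_model E in
       \<exists>x y. singular_mod p M x y \<and> \<not> int p dvd (a1 M)^2 + 4 * (3 * x + a2 M))"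

definition additive_reduction :: "rat weierstrass \<Rightarrow> nat \<Rightarrow> bool" where
  "additive_reduction E p \<longleftrightarrow> bad_reduction E p \<and> \<not> multiplicative_reduction E p"


section \<open>Wild ramification of the torsion points\<close>

definition complex_ring_on :: "complex set \<Rightarrow> complex ring" where
  "complex_ring_on S = \<lparr>carrier = S, monoid.mult = (*), one = 1, zero = 0, add = (+)\<rparr>"

definition complex_torsion :: "rat weierstrass \<Rightarrow> nat \<Rightarrow> complex point set" where
  "complex_torsion E l = torsion (map_weierstrass of_rat E) l"

text \<open>The number field \<open>\<rat>(E[l])\<close>, as a subfield of \<open>\<complex>\<close>.\<close>

definition torsion_field :: "rat weierstrass \<Rightarrow> nat \<Rightarrow> complex set" where
  "torsion_field E l = generate_field (complex_ring_on UNIV) (\<Union> (set_point ` complex_torsion E l))"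

definition integers_of :: "complex set \<Rightarrow> complex ring" where
  "integers_of L = complex_ring_on {x \<in> L. algebraic_int x}"

text \<open>
  Automorphisms of \<open>L\<close>, represented by functions undefined outside \<open>L\<close>, so that distinct functions
  are distinct automorphisms.
\<close>

definition galois_group :: "complex set \<Rightarrow> (complex \<Rightarrow> complex) set" where
  "galois_group L = ring_iso (complex_ring_on L) (complex_ring_on L) \<inter> extensional L"

definition ideal_power :: "('a, 'b) ring_scheme \<Rightarrow> 'a set \<Rightarrow> nat \<Rightarrow> 'a set" where
  "ideal_power R I n = (ideal_prod R I ^^ n) (carrier R)"

text \<open>
  The primes of \<open>L\<close> above \<open>p\<close> are conjugate, so nothing below depends on the choice. Choosing such
  a prime amounts to embedding \<open>L\<close> into an algebraic closure of \<open>\<rat>\<^sub>p\<close>.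
\<close>

definition prime_above :: "complex set \<Rightarrow> nat \<Rightarrow> complex set" where
  "prime_above L p = (SOME P. primeideal P (integers_of L) \<and> of_nat p \<in> P)"

text \<open>
  The \<open>i\<close>-th ramification group in the lower numbering. It coincides with the one of the completion
  of \<open>L\<close> at the chosen prime over \<open>\<rat>\<^sub>p\<close>; for \<open>i = 0\<close> it is the inertia group.
\<close>

definition ramification_group :: "complex set \<Rightarrow> nat \<Rightarrow> nat \<Rightarrow> (complex \<Rightarrow> complex) set" where
  "ramification_group L p i =
     {\<sigma> \<in> galois_group L. \<forall>x \<in> carrier (integers_of L).
        \<sigma> x - x \<in> ideal_power (integers_of L) (prime_above L p) (Suc i)}"

definition fixed_torsion ::
    "rat weierstrass \<Rightarrow> nat \<Rightarrow> (complex \<Rightarrow> complex) set \<Rightarrow> complex point set" where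
  "fixed_torsion E l G = {P \<in> complex_torsion E l. \<forall>\<sigma> \<in> G. map_point \<sigma> P = P}"

text \<open>
  The dimension of the \<open>\<bbbF>\<^sub>l\<close>-vector space \<open>E[l] / E[l]\<^sup>G\<close>, as the logarithm to base \<open>l\<close> of its
  cardinality.
\<close>

definition torsion_codim :: "rat weierstrass \<Rightarrow> nat \<Rightarrow> (complex \<Rightarrow> complex) set \<Rightarrow> real" where
  "torsion_codim E l G =
     log (real l) (real (card (complex_torsion E l)) / real (card (fixed_torsion E l G)))"

text \<open>
  \<open>\<delta>\<^sub>p = \<Sum>\<^bsub>i \<ge> 1\<^esub> |G\<^sub>i| / |G\<^sub>0| \<cdot> dim (E[l] / E[l]\<^bsup>G\<^sub>i\<^esup>)\<close>, for a prime \<open>l \<noteq> p\<close>. Almost all terms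
  vanish, and the sum is an integer which does not depend on \<open>l\<close>.
\<close>

definition wild_conductor :: "rat weierstrass \<Rightarrow> nat \<Rightarrow> nat \<Rightarrow> real" where
  "wild_conductor E l p =
     (let G = ramification_group (torsion_field E l) p in
      \<Sum>i. real (card (G (Suc i))) / real (card (G 0)) * torsion_codim E l (G (Suc i)))"


section \<open>Conductor\<close>

text \<open>
  The exponent is \<open>0\<close>, \<open>1\<close> or \<open>2 + \<delta>\<^sub>p\<close> for good, multiplicative and additive reduction; \<open>floor\<close> only
  converts the integer \<open>\<delta>\<^sub>p\<close> to type \<open>nat\<close>. For \<open>p \<ge> 5\<close> one has \<open>\<delta>\<^sub>p = 0\<close>.
\<close>

definition conductor_exponent :: "rat weierstrass \<Rightarrow> nat \<Rightarrow> nat" where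
  "conductor_exponent E p =
     (if additive_reduction E p then 2 + nat \<lfloor>wild_conductor E (if p = 2 then 3 else 2) p\<rfloor>
      else if multiplicative_reduction E p then 1
      else 0)"

definition conductor :: "rat weierstrass \<Rightarrow> nat" where
  "conductor E = (\<Prod>p | prime p \<and> bad_reduction E p. p ^ conductor_exponent E p)"

end

theory Submission
  imports Defs
begin

text \<open>
  Moving a rational point of order 7 to the origin brings the curve to Tate's normal form with
  \<open>c = d\<^sup>2 - d\<close> and \<open>b = d\<^sup>3 - d\<^sup>2\<close>. Writing \<open>d = m / n\<close> in lowest terms and clearing denominators
  gives an integral model of discriminant \<open>(m n (m - n))\<^sup>7 F(m, n)\<close>, where
  \<open>F(m, n) = m\<^sup>3 - 8 m\<^sup>2 n + 5 m n\<^sup>2 + n\<^sup>3\<close>. It is minimal: a prime dividing both its discriminant and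
  \<open>c\<^sub>4\<close> is 7, and the exponent of 7 in \<open>F(m, n)\<close> is at most 2.

  The primes dividing the conductor are those dividing the minimal discriminant, and 2 is always one
  of them, as it divides \<open>m n (m - n)\<close>. If the only other one, \<open>q\<close>, divides \<open>m n (m - n)\<close> as well, then
  \<open>F(m, n) = \<plusminus>1\<close>, since \<open>F(m, n)\<close> is prime to \<open>m n (m - n)\<close>; moreover one of the pairwise
  coprime numbers \<open>m\<close>, \<open>n\<close>, \<open>m - n\<close> is a unit, and the resulting cubic equation in one variable has
  only solutions with \<open>m n (m - n) = 0\<close>. Otherwise two of the three numbers are units and the third
  is \<open>\<plusminus>2\<close>; all these cases have discriminant \<open>- 2\<^sup>7 \<cdot> 13\<close>.
\<close>

section \<open>Changes of variables\<close>

text \<open>An isomorphism with scaling \<open>u\<close> divides \<open>c4\<close> by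
  \<open>u^4\<close> and the discriminant by \<open>u^12\<close>, so an integral model that is not
  minimal at a prime has \<open>c4\<close> divisible by it. Minimality is tested this way
  below.\<close>

definition c4 :: "'a::comm_ring_1 weierstrass \<Rightarrow> 'a" where
  "c4 W = (b2 W)^2 - 24 * b4 W"

text \<open>Completing the square explains why \<open>s\<close> and \<open>t\<close> disappear: what
  is left is the shift by \<open>r\<close> of the cubic \<open>4 x^3 + b2 x^2 + 2 b4 x + b6\<close>,
  and the new \<open>b8\<close> is the value at \<open>r\<close> of the 3-division polynomial
  \<open>3 x^4 + b2 x^3 + 3 b4 x^2 + 3 b6 x + b8\<close>.\<close>

lemma change_of_variables_b:
  assumes "change_of_variables u r s t W V"
  shows "u^2 * b2 V = b2 W + 12 * r"
    and "u^4 * b4 V = b4 W + r * b2 W + 6 * r^2"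
    and "u^6 * b6 V = b6 W + 2 * r * b4 W + r^2 * b2 W + 4 * r^3"
    and "u^8 * b8 V = b8 W + 3 * r * b6 W + 3 * r^2 * b4 W + r^3 * b2 W + 3 * r^4"
proof -
  note c = assms[unfolded change_of_variables_def]
  \<comment> \<open>With coefficients weighted by powers of \<open>u\<close>, the right-hand sides
    in \<open>e\<close> are free of \<open>u\<close>, and only polynomial identities remain.\<close>
  define A1 A2 A3 A4 A6 where A: "A1 = u * a1 V" "A2 = u^2 * a2 V" "A3 = u^3 * a3 V"
    "A4 = u^4 * a4 V" "A6 = u^6 * a6 V"
  have e: "A1 = a1 W + 2 * s" "A2 = a2 W - s * a1 W + 3 * r - s^2"
    "A3 = a3 W + r * a1 W + 2 * t"
    "A4 = a4 W - s * a3 W + 2 * r * a2 W - (t + r * s) * a1 W + 3 * r^2 - 2 * s * t"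
    "A6 = a6 W + r * a4 W + r^2 * a2 W + r^3 - t * a3 W - t^2 - r * t * a1 W"
    using c by (simp_all add: A)
  have "u^2 * b2 V = A1^2 + 4 * A2" unfolding A b2_def by Groebner_Basis.algebra
  also have "\<dots> = b2 W + 12 * r" unfolding e b2_def by Groebner_Basis.algebra
  finally show "u^2 * b2 V = b2 W + 12 * r" .
  have "u^4 * b4 V = 2 * A4 + A1 * A3" unfolding A b4_def by Groebner_Basis.algebra
  also have "\<dots> = b4 W + r * b2 W + 6 * r^2" unfolding e b2_def b4_def by Groebner_Basis.algebra
  finally show "u^4 * b4 V = b4 W + r * b2 W + 6 * r^2" .
  have "u^6 * b6 V = A3^2 + 4 * A6" unfolding A b6_def by Groebner_Basis.algebra
  also have "\<dots> = b6 W + 2 * r * b4 W + r^2 * b2 W + 4 * r^3"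
    unfolding e b2_def b4_def b6_def by Groebner_Basis.algebra
  finally show "u^6 * b6 V = b6 W + 2 * r * b4 W + r^2 * b2 W + 4 * r^3" .
  have "u^8 * b8 V = A1^2 * A6 + 4 * A2 * A6 - A1 * A3 * A4 + A2 * A3^2 - A4^2"
    unfolding A b8_def by Groebner_Basis.algebra
  also have "\<dots> = b8 W + 3 * r * b6 W + 3 * r^2 * b4 W + r^3 * b2 W + 3 * r^4"
    unfolding e b2_def b4_def b6_def b8_def by Groebner_Basis.algebra
  finally show "u^8 * b8 V = b8 W + 3 * r * b6 W + 3 * r^2 * b4 W + r^3 * b2 W + 3 * r^4" .
qed

lemma change_of_variables_c4:
  assumes "change_of_variables u r s t W V"
  shows "u^4 * c4 V = c4 W"
proof -
  have "u^4 * c4 V = (u^2 * b2 V)^2 - 24 * (u^4 * b4 V)" unfolding c4_def by Groebner_Basis.algebra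
  also have "\<dots> = c4 W"
    unfolding change_of_variables_b[OF assms] c4_def by Groebner_Basis.algebra
  finally show ?thesis .
qed

text \<open>The factor 4 makes \<open>b8\<close> an integral polynomial in the other three, which
  eliminates it from the discriminant; characteristic 0 later allows the 4 to be cancelled.\<close>

lemma four_b8:
  fixes W :: "'a::idom weierstrass"
  shows "4 * b8 W = b2 W * b6 W - (b4 W)^2"
  unfolding b2_def b4_def b6_def b8_def by Groebner_Basis.algebra

lemma four_discriminant:
  fixes W :: "'a::idom weierstrass"
  shows "4 * discriminant W = - ((b2 W)^2 * (b2 W * b6 W - (b4 W)^2)) - 32 * (b4 W)^3
     - 108 * (b6 W)^2 + 36 * b2 W * b4 W * b6 W"
  unfolding discriminant_def four_b8[symmetric] by Groebner_Basis.algebra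

lemma change_of_variables_discriminant:
  fixes W V :: "'a::field_char_0 weierstrass"
  assumes "change_of_variables u r s t W V"
  shows "u^12 * discriminant V = discriminant W"
proof -
  have "4 * (u^12 * discriminant V) = u^12 * (4 * discriminant V)" by simp
  also have "\<dots> = - ((u^2 * b2 V)^2 * ((u^2 * b2 V) * (u^6 * b6 V) - (u^4 * b4 V)^2))
      - 32 * (u^4 * b4 V)^3
      - 108 * (u^6 * b6 V)^2 + 36 * (u^2 * b2 V) * (u^4 * b4 V) * (u^6 * b6 V)"
    unfolding four_discriminant by Groebner_Basis.algebra
  also have "\<dots> = 4 * discriminant W"
    unfolding change_of_variables_b[OF assms] four_discriminant by Groebner_Basis.algebra
  finally show ?thesis by simp
qed

text \<open>The parameters are read off by substituting one linear change of coordinates into the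
  other.\<close>

lemma change_of_variables_trans:
  assumes "change_of_variables u r s t W V" "change_of_variables u' r' s' t' V X"
  shows "change_of_variables (u * u') (r + u^2 * r') (s + u * s') (t + u^3 * t' + u^2 * s * r') W X"
proof -
  have W: "u * a1 V = a1 W + 2 * s"
    "u^2 * a2 V = a2 W - s * a1 W + 3 * r - s^2"
    "u^3 * a3 V = a3 W + r * a1 W + 2 * t"
    "u^4 * a4 V = a4 W - s * a3 W + 2 * r * a2 W - (t + r * s) * a1 W + 3 * r^2 - 2 * s * t"
    "u^6 * a6 V = a6 W + r * a4 W + r^2 * a2 W + r^3 - t * a3 W - t^2 - r * t * a1 W"
    using assms(1) by (auto simp: change_of_variables_def)
  have V: "u' * a1 X = a1 V + 2 * s'"
    "u'^2 * a2 X = a2 V - s' * a1 V + 3 * r' - s'^2"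
    "u'^3 * a3 X = a3 V + r' * a1 V + 2 * t'"
    "u'^4 * a4 X = a4 V - s' * a3 V + 2 * r' * a2 V - (t' + r' * s') * a1 V + 3 * r'^2 - 2 * s' * t'"
    "u'^6 * a6 X = a6 V + r' * a4 V + r'^2 * a2 V + r'^3 - t' * a3 V - t'^2 - r' * t' * a1 V"
    using assms(2) by (auto simp: change_of_variables_def)
  have "(u * u') * a1 X = u * (u' * a1 X)" by simp
  also have "\<dots> = a1 W + 2 * (s + u * s')" unfolding V(1) using W(1) by Groebner_Basis.algebra
  finally have 1: "(u * u') * a1 X = a1 W + 2 * (s + u * s')" .
  have "(u * u')^2 * a2 X = u^2 * (u'^2 * a2 X)" by Groebner_Basis.algebra
  also have "\<dots> = u^2 * a2 V - (u * s') * (u * a1 V) + 3 * u^2 * r' - u^2 * s'^2"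
    unfolding V by Groebner_Basis.algebra
  also have "\<dots> = a2 W - (s + u * s') * a1 W + 3 * (r + u^2 * r') - (s + u * s')^2"
    unfolding W by Groebner_Basis.algebra
  finally have 2: "(u * u')^2 * a2 X = \<dots>" .
  have "(u * u')^3 * a3 X = u^3 * (u'^3 * a3 X)" by Groebner_Basis.algebra
  also have "\<dots> = u^3 * a3 V + u^2 * r' * (u * a1 V) + 2 * u^3 * t'"
    unfolding V by Groebner_Basis.algebra
  also have "\<dots> = a3 W + (r + u^2 * r') * a1 W + 2 * (t + u^3 * t' + u^2 * s * r')"
    unfolding W by Groebner_Basis.algebra
  finally have 3: "(u * u')^3 * a3 X = \<dots>" .
  have "(u * u')^4 * a4 X = u^4 * (u'^4 * a4 X)" by Groebner_Basis.algebra
  also have "\<dots> = u^4 * a4 V - u * s' * (u^3 * a3 V) + 2 * u^2 * r' * (u^2 * a2 V)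
     - (u^3 * t' + u^3 * r' * s') * (u * a1 V) + 3 * u^4 * r'^2 - 2 * u^4 * s' * t'"
    unfolding V by Groebner_Basis.algebra
  also have "\<dots> = a4 W - (s + u * s') * a3 W + 2 * (r + u^2 * r') * a2 W
     - ((t + u^3 * t' + u^2 * s * r') + (r + u^2 * r') * (s + u * s')) * a1 W
     + 3 * (r + u^2 * r')^2 - 2 * (s + u * s') * (t + u^3 * t' + u^2 * s * r')"
    unfolding W by Groebner_Basis.algebra
  finally have 4: "(u * u')^4 * a4 X = \<dots>" .
  have "(u * u')^6 * a6 X = u^6 * (u'^6 * a6 X)" by Groebner_Basis.algebra
  also have "\<dots> = u^6 * a6 V + u^2 * r' * (u^4 * a4 V) + u^4 * r'^2 * (u^2 * a2 V)
     + u^6 * r'^3 - u^3 * t' * (u^3 * a3 V) - u^6 * t'^2 - u^5 * r' * t' * (u * a1 V)"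
    unfolding V by Groebner_Basis.algebra
  also have "\<dots> = a6 W + (r + u^2 * r') * a4 W + (r + u^2 * r')^2 * a2 W + (r + u^2 * r')^3
     - (t + u^3 * t' + u^2 * s * r') * a3 W - (t + u^3 * t' + u^2 * s * r')^2
     - (r + u^2 * r') * (t + u^3 * t' + u^2 * s * r') * a1 W"
    unfolding W by Groebner_Basis.algebra
  finally have 6: "(u * u')^6 * a6 X = \<dots>" .
  show ?thesis
    using assms 1 2 3 4 6 unfolding change_of_variables_def by (simp only: mult_eq_0_iff simp_thms)
qed

lemma isomorphic_trans: "isomorphic W V \<Longrightarrow> isomorphic V X \<Longrightarrow> isomorphic W X"
  unfolding isomorphic_def using change_of_variables_trans by blast

section \<open>Transport of the group law along a change of variables\<close>

text \<open>Solves the substitution of \<open>change_of_variables\<close> for the new coordinates,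
  so it maps points of \<open>W\<close> to points of \<open>V\<close>.\<close>

fun transform_point :: "'a::field \<Rightarrow> 'a \<Rightarrow> 'a \<Rightarrow> 'a \<Rightarrow> 'a point \<Rightarrow> 'a point" where
  "transform_point u r s t Infinity = Infinity"
| "transform_point u r s t (Affine x y) =
     Affine ((x - r) / u^2) ((y - s * (x - r) - t) / u^3)"

text \<open>The substitution is affine and takes a line of slope \<open>l\<close> to one of slope
  \<open>(l - s) / u\<close>. Only the slope enters, so chords and tangents are treated
  together.\<close>

lemma third_point_transform:
  fixes u :: "'a::field"
  assumes u: "u \<noteq> 0" and l: "l' = (l - s) / u"
   and W: "u * A1 = B1 + 2 * s"
    "u^2 * A2 = B2 - s * B1 + 3 * r - s^2"
    "u^3 * A3 = B3 + r * B1 + 2 * t"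
    and x3: "x3 = l^2 + B1 * l - B2 - x1 - x2"
  shows "l'^2 + A1 * l' - A2 - (x1 - r) / u^2 - (x2 - r) / u^2 = (x3 - r) / u^2"
   and "- (l' * ((x3 - r) / u^2 - (x1 - r) / u^2) + (y1 - s * (x1 - r) - t) / u^3)
     - A1 * ((x3 - r) / u^2) - A3
     = (- (l * (x3 - x1) + y1) - B1 * x3 - B3 - s * (x3 - r) - t) / u^3"
proof -
  have A: "A1 = (B1 + 2 * s) / u" "A2 = (B2 - s * B1 + 3 * r - s^2) / u^2"
     "A3 = (B3 + r * B1 + 2 * t) / u^3"
    using u W by (simp_all add: field_simps)
  show "l'^2 + A1 * l' - A2 - (x1 - r) / u^2 - (x2 - r) / u^2 = (x3 - r) / u^2"
    unfolding A x3 l using u by (simp add: divide_simps) Groebner_Basis.algebra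
  show "- (l' * ((x3 - r) / u^2 - (x1 - r) / u^2) + (y1 - s * (x1 - r) - t) / u^3)
     - A1 * ((x3 - r) / u^2) - A3
     = (- (l * (x3 - x1) + y1) - B1 * x3 - B3 - s * (x3 - r) - t) / u^3"
    unfolding A l using u by (simp add: divide_simps) Groebner_Basis.algebra
qed

text \<open>
  No point is assumed to be on the curve; the second hypothesis prevents the tangent slope at \<open>P\<close>
  from being the junk value of a division by zero.
\<close>

lemma add_points_transform:
  assumes ch: "change_of_variables u r s t W V" and two: "add_points W P P \<noteq> Infinity"
  shows "add_points V (transform_point u r s t P) (transform_point u r s t Q) =
    transform_point u r s t (add_points W P Q)"
proof (cases P)
  case Infinity
  then show ?thesis by simp
next
  case P: (Affine x1 y1)
  show ?thesis
  proof (cases Q)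
    case Infinity
    then show ?thesis using P by simp
  next
    case Q: (Affine x2 y2)
    have W: "u \<noteq> 0" "u * a1 V = a1 W + 2 * s"
    "u^2 * a2 V = a2 W - s * a1 W + 3 * r - s^2"
    "u^3 * a3 V = a3 W + r * a1 W + 2 * t"
    "u^4 * a4 V = a4 W - s * a3 W + 2 * r * a2 W - (t + r * s) * a1 W + 3 * r^2 - 2 * s * t"
      using ch by (auto simp: change_of_variables_def)
    have A: "a1 V = (a1 W + 2 * s) / u" "a2 V = (a2 W - s * a1 W + 3 * r - s^2) / u^2"
     "a3 V = (a3 W + r * a1 W + 2 * t) / u^3"
     "a4 V = (a4 W - s * a3 W + 2 * r * a2 W - (t + r * s) * a1 W + 3 * r^2 - 2 * s * t) / u^4"
      using W by (simp_all add: field_simps)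
    have eqx: "(x1 - r) / u^2 = (x2 - r) / u^2 \<longleftrightarrow> x1 = x2"
      using W(1) by (simp add: divide_simps)
    have y: "(y1 - s * (x2 - r) - t) / u^3 + (y2 - s * (x2 - r) - t) / u^3
       + a1 V * ((x2 - r) / u^2) + a3 V = (y1 + y2 + a1 W * x2 + a3 W) / u^3"
      unfolding A using W(1) by (simp add: divide_simps) Groebner_Basis.algebra
    have eqy: "(y1 - s * (x2 - r) - t) / u^3 + (y2 - s * (x2 - r) - t) / u^3
       + a1 V * ((x2 - r) / u^2) + a3 V = 0 \<longleftrightarrow> y1 + y2 + a1 W * x2 + a3 W = 0"
      unfolding y using W(1) by simp
    show ?thesis
    proof (cases "x1 = x2 \<and> y1 + y2 + a1 W * x2 + a3 W = 0")
      case True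
      then show ?thesis using eqy by (simp add: P Q)
    next
      case False
      define l where "l = (if x1 = x2
                 then (3 * x1^2 + 2 * a2 W * x1 + a4 W - a1 W * y1) / (2 * y1 + a1 W * x1 + a3 W)
                 else (y2 - y1) / (x2 - x1))"
      define X1 X2 Y1 Y2 where XY: "X1 = (x1 - r) / u^2" "X2 = (x2 - r) / u^2"
         "Y1 = (y1 - s * (x1 - r) - t) / u^3" "Y2 = (y2 - s * (x2 - r) - t) / u^3"
      define l' where "l' = (if x1 = x2
                 then (3 * X1^2 + 2 * a2 V * X1 + a4 V - a1 V * Y1) / (2 * Y1 + a1 V * X1 + a3 V)
                 else (Y2 - Y1) / (X2 - X1))"
      have nz: "2 * y1 + a1 W * x1 + a3 W \<noteq> 0"
      proof
        assume "2 * y1 + a1 W * x1 + a3 W = 0"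
        then have "y1 + y1 + a1 W * x1 + a3 W = 0" by (simp only: mult_2)
        then show False using two by (simp add: P)
      qed
      \<comment> \<open>For tangent and chord alike, the numerator of the slope loses
        \<open>s\<close> times the denominator, hence the shift by \<open>s\<close>; it scales by
        one more power of \<open>u\<close>, hence the division.\<close>
      have l': "l' = (l - s) / u"
      proof (cases "x1 = x2")
        case True
        have den: "2 * Y1 + a1 V * X1 + a3 V = (2 * y1 + a1 W * x1 + a3 W) / u^3"
          unfolding XY A using W(1) by (simp add: divide_simps) Groebner_Basis.algebra
        have num: "3 * X1^2 + 2 * a2 V * X1 + a4 V - a1 V * Y1 =
          (3 * x1^2 + 2 * a2 W * x1 + a4 W - a1 W * y1 - s * (2 * y1 + a1 W * x1 + a3 W)) / u^4"
          unfolding XY A using W(1) by (simp add: divide_simps) Groebner_Basis.algebra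
        have "2 * y1 + a1 W * x1 + a3 W \<noteq> 0" using nz by auto
        moreover have "(n - s * d) / u^4 / (d / u^3) = (n / d - s) / u" if "d \<noteq> 0" for n d
          using that W(1) by (simp add: field_simps power_numeral_reduce)
        ultimately show ?thesis using True unfolding l'_def l_def den num by simp
      next
        case False
        then have "x2 - x1 \<noteq> 0" by simp
        moreover have "(n - s * d) / u^3 / (d / u^2) = (n / d - s) / u" if "d \<noteq> 0" for n d
          using that W(1) by (simp add: field_simps power_numeral_reduce)
        moreover have "Y2 - Y1 = (y2 - y1 - s * (x2 - x1)) / u^3" "X2 - X1 = (x2 - x1) / u^2"
          unfolding XY diff_divide_distrib[symmetric] by (simp_all add: algebra_simps)
        ultimately show ?thesis using False unfolding l'_def l_def by simp
      qed
      note aux = third_point_transform[OF W(1) l' W(2-4) refl, of x1 x2]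
      define x3 where "x3 = l^2 + a1 W * l - a2 W - x1 - x2"
      have AW: "add_points W (Affine x1 y1) (Affine x2 y2) =
          Affine x3 (- (l * (x3 - x1) + y1) - a1 W * x3 - a3 W)"
        unfolding add_points.simps if_not_P[OF False] l_def[symmetric] Let_def x3_def ..
      have AV: "add_points V (Affine X1 Y1) (Affine X2 Y2) = (let x3 = l'^2 + a1 V * l' - a2 V - X1 - X2
        in Affine x3 (- (l' * (x3 - X1) + Y1) - a1 V * x3 - a3 V))"
      proof -
        have "\<not> (X1 = X2 \<and> Y1 + Y2 + a1 V * X2 + a3 V = 0)"
          using False eqx eqy unfolding XY by metis
        moreover have "l' = (if X1 = X2
               then (3 * X1^2 + 2 * a2 V * X1 + a4 V - a1 V * Y1) / (2 * Y1 + a1 V * X1 + a3 V)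
               else (Y2 - Y1) / (X2 - X1))"
          using eqx unfolding l'_def XY by simp
        ultimately show ?thesis unfolding add_points.simps Let_def by (simp only: if_False)
      qed
      show ?thesis
        by (simp only: P Q transform_point.simps XY[symmetric] AV AW Let_def
            aux(1)[folded XY x3_def] aux(2)[of y1, folded XY x3_def])
    qed
  qed
qed

text \<open>The left summand in the recursion is always \<open>P\<close>, so the hypothesis on the
  double of \<open>P\<close> serves every step.\<close>

lemma nsmul_point_transform:
  assumes "change_of_variables u r s t W V" and "add_points W P P \<noteq> Infinity"
  shows "nsmul_point V n (transform_point u r s t P) = transform_point u r s t (nsmul_point W n P)"
  by (induction n) (simp_all add: add_points_transform[OF assms])

section \<open>Tate's normal form\<close>

abbreviation origin :: "'a::field point" where
  "origin \<equiv> Affine 0 0"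

text \<open>Reaching \<open>Infinity\<close> restarts the recursion, so the multiples are periodic;
  associativity of the addition does not enter.\<close>

lemma nsmul_point_mod:
  assumes "nsmul_point W m P = Infinity"
  shows "nsmul_point W n P = nsmul_point W (n mod m) P"
proof -
  have add: "nsmul_point W (m + j) P = nsmul_point W j P" for j
    using assms by (induction j) auto
  have "nsmul_point W (m * k + j) P = nsmul_point W j P" for k j
    by (induction k) (simp_all add: add add.assoc)
  from this[of "n div m" "n mod m"] show ?thesis by simp
qed

lemma add_points_Infinity_right [simp]: "add_points W P Infinity = P"
  by (cases P) simp_all

text \<open>The vanishing of \<open>a4\<close> and \<open>a6\<close> puts the origin on the curve
  with tangent \<open>y = 0\<close>; the equality of \<open>a2\<close> and \<open>a3\<close> fixes
  the scaling.\<close>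

definition tate :: "'a::comm_ring_1 \<Rightarrow> 'a \<Rightarrow> 'a weierstrass" where
  "tate b c = Weierstrass (1 - c) (- b) (- b) 0 0"

text \<open>A first change of variables moves \<open>P\<close> to the origin and makes its tangent
  horizontal; a second one rescales until \<open>a2\<close> and \<open>a3\<close> agree.\<close>

lemma isomorphic_tate:
  fixes E :: "'a::field weierstrass"
  assumes P: "on_curve E P" "P \<noteq> Infinity" "nsmul_point E 7 P = Infinity"
  shows "\<exists>b c. isomorphic E (tate b c) \<and> nsmul_point (tate b c) 7 origin = Infinity"
proof -
  obtain x y where xy: "P = Affine x y" using P(2) by (cases P) auto
  have E: "y^2 + a1 E * x * y + a3 E * y = x^3 + a2 E * x^2 + a4 E * x + a6 E"
    using P(1) xy by simp
  have two: "add_points E P P \<noteq> Infinity"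
  proof
    assume "add_points E P P = Infinity"
    then have "nsmul_point E 2 P = Infinity" by (simp add: numeral_2_eq_2 xy)
    \<comment> \<open>7 is odd, so \<open>P\<close> itself would be \<open>Infinity\<close>.\<close>
    from nsmul_point_mod[OF this, of 7] show False using P(2,3) by simp
  qed
  define A3 where "A3 = 2 * y + a1 E * x + a3 E"
  have A3: "A3 \<noteq> 0"
  proof
    assume "A3 = 0"
    then have "y + y + a1 E * x + a3 E = 0" by (simp only: mult_2 A3_def)
    then show False using two by (simp add: xy)
  qed
  \<comment> \<open>The slope of the tangent at \<open>P\<close>; taking it for \<open>s\<close> is
    what makes \<open>a4\<close> vanish.\<close>
  define l where "l = (3 * x^2 + 2 * a2 E * x + a4 E - a1 E * y) / A3"
  define V where "V = Weierstrass (a1 E + 2 * l) (a2 E - l * a1 E + 3 * x - l^2) A3 0 0"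
  have l: "3 * x^2 + 2 * a2 E * x + a4 E - a1 E * y = l * A3" unfolding l_def using A3 by simp
  have ch: "change_of_variables 1 x l y E V"
  proof -
    have "0 = a4 E - l * a3 E + 2 * x * a2 E - (y + x * l) * a1 E + 3 * x^2 - 2 * l * y"
      using l unfolding A3_def by Groebner_Basis.algebra
    moreover have "0 = a6 E + x * a4 E + x^2 * a2 E + x^3 - y * a3 E - y^2 - x * y * a1 E"
      using E by Groebner_Basis.algebra
    ultimately show ?thesis
      unfolding change_of_variables_def V_def A3_def by simp
  qed
  have o: "transform_point 1 x l y P = origin" by (simp add: xy)
  have sevenV: "nsmul_point V 7 origin = Infinity"
    using nsmul_point_transform[OF ch two, of 7] by (simp add: o P)
  define A2 where "A2 = a2 V"
  define A1 where "A1 = a1 V"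
  have V: "V = Weierstrass A1 A2 A3 0 0" by (simp add: A2_def A1_def V_def)
  have A2: "A2 \<noteq> 0"
  proof
    assume "A2 = 0"
    \<comment> \<open>Without \<open>A2\<close> the tangent \<open>y = 0\<close> meets the curve in
      \<open>x^3 = 0\<close>: the origin is a flex, and 7 is 1 modulo 3.\<close>
    then have "nsmul_point V 3 origin = Infinity"
      using A3 by (simp add: eval_nat_numeral V)
    from nsmul_point_mod[OF this, of 7] show False using sevenV by simp
  qed
  have "add_points V origin origin \<noteq> Infinity" using A3 by (simp add: V)
  \<comment> \<open>The solution of \<open>A2 / u^2 = A3 / u^3\<close>.\<close>
  define u where "u = A3 / A2"
  have u: "u \<noteq> 0" using A2 A3 by (simp add: u_def)
  define T where "T = tate (- A2 / u^2) (1 - A1 / u)"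
  have ch2: "change_of_variables u 0 0 0 V T"
    using A2 A3 by (simp add: change_of_variables_def T_def tate_def V u_def field_simps power_numeral_reduce)
  have o2: "transform_point u 0 0 0 origin = origin" by simp
  have "nsmul_point T 7 origin = Infinity"
    using nsmul_point_transform[OF ch2 \<open>add_points V origin origin \<noteq> Infinity\<close>, of 7]
    by (simp add: o2 sevenV)
  moreover have "isomorphic E T"
    using ch ch2 isomorphic_trans[of E V T] unfolding isomorphic_def by blast
  ultimately show ?thesis unfolding T_def by blast
qed

lemma add_points_origin:
  assumes "x \<noteq> 0" "l = y / x" "x' = l^2 + a1 W * l - a2 W - x"
  shows "add_points W origin (Affine x y) = Affine x' (- (l * x') - a1 W * x' - a3 W)"
  using assms by (simp add: Let_def)

text \<open>The multiples of the origin are computed in turn. The parameters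
  \<open>r = b / c\<close> and \<open>s = c / (r - 1)\<close> keep the coordinates up to the fifth
  multiple polynomial, and each vanishing denominator would make a smaller multiple
  \<open>Infinity\<close>.\<close>

lemma tate_seven_torsion:
  fixes b c :: "'a::field"
  assumes b: "b \<noteq> 0" and seven: "nsmul_point (tate b c) 7 origin = Infinity"
  shows "\<exists>d. c = d^2 - d \<and> b = d^3 - d^2"
proof -
  let ?T = "tate b c"
  have Suc: "nsmul_point ?T (Suc n) origin = add_points ?T origin (nsmul_point ?T n origin)" for n
    by simp
  have [simp]: "a1 ?T = 1 - c" "a2 ?T = - b" "a3 ?T = - b" "a4 ?T = 0"
    by (simp_all add: tate_def)
  \<comment> \<open>\<open>Affine 0 b\<close> is the negative of the origin.\<close>
  have neg: "add_points ?T origin (Affine 0 b) = Infinity" by simp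
  have two: "nsmul_point ?T 2 origin = Affine b (b * c)"
    using b by (simp add: numeral_2_eq_2 algebra_simps)
  have three: "nsmul_point ?T 3 origin = Affine c (b - c)"
    using Suc[of 2] unfolding two
    using add_points_origin[of b c "b * c" c ?T] b by (simp add: algebra_simps power2_eq_square)
  have c: "c \<noteq> 0"
  proof
    assume "c = 0"
    \<comment> \<open>Now the third multiple is the negative of the origin, and 7 is 3 modulo 4. The
      exclusions of \<open>r = 1\<close> and \<open>s = 1\<close> work alike with the fourth and the
      fifth multiple.\<close>
    then have "nsmul_point ?T 4 origin = Infinity" using Suc[of 3] three neg by simp
    from nsmul_point_mod[OF this, of 7] show False using seven three by simp
  qed
  define r where "r = b / c"
  have r: "b = r * c" "r \<noteq> 0" using b c by (simp_all add: r_def)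
  have four: "nsmul_point ?T 4 origin = Affine (r * (r - 1)) (r^2 * (c - r + 1))"
  proof -
    have "(b - c) / c = r - 1" using c by (simp add: r_def diff_divide_distrib)
    moreover have "(r - 1)^2 + (1 - c) * (r - 1) + b - c = r * (r - 1)"
      unfolding r(1) by Groebner_Basis.algebra
    moreover have "- ((r - 1) * (r * (r - 1))) - (1 - c) * (r * (r - 1)) + b = r^2 * (c - r + 1)"
      unfolding r(1) by Groebner_Basis.algebra
    ultimately show ?thesis
      using Suc[of 3] add_points_origin[of c "r - 1" "b - c" "r * (r - 1)" ?T] three c
      by (simp del: nsmul_point.simps)
  qed
  have r1: "r \<noteq> 1"
  proof
    assume "r = 1"
    then have "nsmul_point ?T 5 origin = Infinity" using Suc[of 4] four neg r by simp
    from nsmul_point_mod[OF this, of 7] show False using seven two by simp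
  qed
  define s where "s = c / (r - 1)"
  have s: "c = s * (r - 1)" "s \<noteq> 0" using c r1 by (simp_all add: s_def)
  have five: "nsmul_point ?T 5 origin = Affine (r * s * (s - 1)) (r * s^2 * (r - s))"
  proof -
    have "r^2 * (c - r + 1) / (r * (r - 1)) = r * (s - 1)"
      using r(2) r1 unfolding s(1) by (simp add: divide_simps) Groebner_Basis.algebra
    moreover have "(r * (s - 1))^2 + (1 - c) * (r * (s - 1)) + b - r * (r - 1) = r * s * (s - 1)"
      unfolding r(1) s(1) by Groebner_Basis.algebra
    moreover have "- (r * (s - 1) * (r * s * (s - 1))) - (1 - c) * (r * s * (s - 1)) + b = r * s^2 * (r - s)"
      unfolding r(1) s(1) by Groebner_Basis.algebra
    ultimately show ?thesis
      using Suc[of 4] add_points_origin[of "r * (r - 1)" "r * (s - 1)" "r^2 * (c - r + 1)" "r * s * (s - 1)" ?T]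
        four r(2) r1 by (simp del: nsmul_point.simps)
  qed
  have s1: "s \<noteq> 1"
  proof
    assume s1: "s = 1"
    have "nsmul_point ?T 6 origin = add_points ?T origin (Affine 0 b)"
      using Suc[of 5] unfolding five s1 using r s by (simp add: s1)
    then have "nsmul_point ?T 6 origin = Infinity" using neg by simp
    from nsmul_point_mod[OF this, of 7] show False using seven by simp
  qed
  define l where "l = s * (r - s) / (s - 1)"
  define x where "x = l^2 + (1 - c) * l + b - r * s * (s - 1)"
  have "r * s^2 * (r - s) / (r * s * (s - 1)) = l"
    using r(2) s(2) s1 unfolding l_def by (simp add: divide_simps power2_eq_square)
  then have "nsmul_point ?T 6 origin = Affine x (- (l * x) - (1 - c) * x + b)"
    using Suc[of 5] add_points_origin[of "r * s * (s - 1)" l "r * s^2 * (r - s)" x ?T]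
      five r(2) s(2) s1 by (simp add: x_def del: nsmul_point.simps)
  \<comment> \<open>For \<open>x\<close> different from 0, the chord to the origin would give an
    affine seventh multiple.\<close>
  then have "x = 0"
    using Suc[of 6] seven by (auto simp: Let_def simp del: nsmul_point.simps split: if_splits)
  have "l * (s - 1) = s * (r - s)" using s1 by (simp add: l_def)
  \<comment> \<open>\<open>6 P = - P\<close> forces \<open>r = s\<close>, which is the parameter \<open>d\<close>\<close>
  have "s * (r - 1) * (r - s) = (s * (r - s))^2 + (1 - c) * (s * (r - s)) * (s - 1)
      + (b - r * s * (s - 1)) * (s - 1)^2"
    unfolding r(1) s(1) by Groebner_Basis.algebra
  also have "\<dots> = x * (s - 1)^2"
    unfolding \<open>l * (s - 1) = s * (r - s)\<close>[symmetric] x_def by Groebner_Basis.algebra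
  finally have "s * (r - 1) * (r - s) = 0" using \<open>x = 0\<close> by simp
  then have "r = s" using s r1 by auto
  then show ?thesis using r s by (intro exI[of _ r]) (simp add: algebra_simps power_numeral_reduce)
qed

section \<open>The integral model\<close>

text \<open>The homogenized factor \<open>d^3 - 8 d^2 + 5 d + 1\<close> of the discriminant of
  Tate's form; its other factors are powers of \<open>d\<close> and \<open>d - 1\<close>.\<close>

definition tate_seven_cubic :: "int \<Rightarrow> int \<Rightarrow> int" where
  "tate_seven_cubic m n = m^3 - 8 * m^2 * n + 5 * m * n^2 + n^3"

text \<open>The Tate normal form with parameter \<open>d = m / n\<close>, rescaled by \<open>u = 1 / n\<^sup>2\<close> to clear denominators.\<close>

definition tate_seven :: "int \<Rightarrow> int \<Rightarrow> int weierstrass" where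
  "tate_seven m n = Weierstrass (n^2 + m * n - m^2) (m^2 * n^2 - m^3 * n) (m^2 * n^4 - m^3 * n^3) 0 0"

lemma discriminant_tate_seven:
  "discriminant (tate_seven m n) = (m * n * (m - n))^7 * tate_seven_cubic m n"
proof -
  \<comment> \<open>Here \<open>a2\<close> is \<open>B\<close> and \<open>a3\<close> is
    \<open>n^2 * B\<close>, so \<open>n^4 * B^3\<close> splits off before anything is expanded in
    \<open>m\<close> and \<open>n\<close>.\<close>
  define A B where "A = n^2 + m * n - m^2" and "B = m^2 * n * (n - m)"
  have T: "tate_seven m n = Weierstrass A B (n^2 * B) 0 0"
    unfolding tate_seven_def A_def B_def by (simp add: algebra_simps power_numeral_reduce)
  have "discriminant (tate_seven m n) = n^4 * B^3 *
      (- ((A^2 + 4 * B)^2) - 8 * A^3 * n^2 - 27 * n^4 * B + 9 * (A^2 + 4 * B) * A * n^2)"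
    unfolding T discriminant_def b2_def b4_def b6_def b8_def
    by (simp add: algebra_simps power_numeral_reduce)
  also have "- ((A^2 + 4 * B)^2) - 8 * A^3 * n^2 - 27 * n^4 * B + 9 * (A^2 + 4 * B) * A * n^2 =
      - (m * (m - n)^4 * tate_seven_cubic m n)"
    unfolding A_def B_def tate_seven_cubic_def by Groebner_Basis.algebra
  also have "n^4 * B^3 * - (m * (m - n)^4 * tate_seven_cubic m n) = (m * n * (m - n))^7 * tate_seven_cubic m n"
    unfolding B_def by (simp add: power_mult_distrib) Groebner_Basis.algebra
  finally show ?thesis .
qed

lemma c4_tate_seven:
  "c4 (tate_seven m n) = m^8 - 12 * m^7 * n + 42 * m^6 * n^2 - 56 * m^5 * n^3 + 35 * m^4 * n^4
     - 14 * m^2 * n^6 + 4 * m * n^7 + n^8"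
  unfolding c4_def b2_def b4_def tate_seven_def weierstrass.sel
  by Groebner_Basis.algebra

lemma map_discriminant: "discriminant (map_weierstrass rat_of_int M) = of_int (discriminant M)"
  by (simp add: discriminant_def b2_def b4_def b6_def b8_def weierstrass.map_sel)

lemma map_c4: "c4 (map_weierstrass rat_of_int M) = of_int (c4 M)"
  by (simp add: c4_def b2_def b4_def weierstrass.map_sel)

lemma integral_model_tate_seven:
  assumes "elliptic_curve E" "torsion E 7 \<noteq> {Infinity}"
  obtains m n where "coprime m n" "integral_model E (tate_seven m n)"
proof -
  have "Infinity \<in> torsion E 7" by (simp add: torsion_def eval_nat_numeral)
  then obtain P where P: "P \<in> torsion E 7" "P \<noteq> Infinity" using assms(2) by blast
  then obtain b c where bc: "isomorphic E (tate b c)" "nsmul_point (tate b c) 7 origin = Infinity"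
    using isomorphic_tate[of E P] by (auto simp: torsion_def)
  have "b \<noteq> 0"
  proof
    assume "b = 0"
    \<comment> \<open>For \<open>b = 0\<close> the origin is a singular point.\<close>
    then have "discriminant (tate b c) = 0"
      by (simp add: tate_def discriminant_def b4_def b6_def b8_def)
    then show False using assms(1) bc(1) change_of_variables_discriminant
      unfolding isomorphic_def elliptic_curve_def by fastforce
  qed
  then obtain d where d: "c = d^2 - d" "b = d^3 - d^2" using tate_seven_torsion bc(2) by blast
  obtain m n where mn: "quotient_of d = (m, n)" by fastforce
  have n: "n > 0" "coprime m n" "d = of_int m / of_int n"
    using mn quotient_of_denom_pos quotient_of_coprime quotient_of_div by blast+
  have "change_of_variables (1 / of_int n ^ 2) 0 0 0 (tate b c) (map_weierstrass rat_of_int (tate_seven m n))"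
    using n(1) unfolding change_of_variables_def d n(3)
    by (simp add: tate_def tate_seven_def weierstrass.map_sel divide_simps)
      (simp add: algebra_simps power_numeral_reduce)
  then have "isomorphic (tate b c) (map_weierstrass rat_of_int (tate_seven m n))"
    unfolding isomorphic_def by blast
  then show thesis using that n(2) bc(1) isomorphic_trans unfolding integral_model_def by blast
qed

section \<open>Minimality of the integral model\<close>

lemma tate_seven_cubic_seven_power:
  assumes "7^3 dvd tate_seven_cubic m n"
  shows "7 dvd n"
proof -
  \<comment> \<open>modulo 7 the cubic form is a cube\<close>
  have "tate_seven_cubic m n = (m + 2 * n)^3 - 7 * (2 * m^2 * n + m * n^2 + n^3)"
    unfolding tate_seven_cubic_def by Groebner_Basis.algebra
  moreover have "7 dvd tate_seven_cubic m n" using assms by (rule dvd_trans[rotated]) simp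
  ultimately have "7 dvd (m + 2 * n)^3" by presburger
  then have "7 dvd m + 2 * n" using prime_dvd_power[of "7::int"] by simp
  then obtain k where "m + 2 * n = 7 * k" by blast
  then have m: "m = 7 * k - 2 * n" by simp
  \<comment> \<open>After the substitution every term but \<open>- 49 * n^3\<close> is divisible by
    \<open>7^3\<close>.\<close>
  have "tate_seven_cubic m n + 49 * n^3 = 7^3 * (k^3 - 2 * k^2 * n + k * n^2)"
    unfolding tate_seven_cubic_def m by Groebner_Basis.algebra
  then have "7^3 dvd tate_seven_cubic m n + 49 * n^3" by simp
  then have "7^3 dvd 49 * n^3" using assms dvd_add_right_iff by blast
  then have "49 * 7 dvd 49 * n^3" by simp
  then have "7 dvd n^3" unfolding dvd_mult_cancel_left by simp
  then show ?thesis using prime_dvd_power[of "7::int"] by simp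
qed

text \<open>\<open>c4\<close> is congruent to \<open>n^8\<close> modulo \<open>m\<close> and modulo
  \<open>m - n\<close>, and to \<open>m^8\<close> modulo \<open>n\<close>, so a common prime would
  divide both \<open>m\<close> and \<open>n\<close>. For the cubic, a combination with
  \<open>c4\<close> equals \<open>7^2 * n^10\<close>.\<close>

lemma prime_dvd_c4_tate_seven:
  fixes p :: int
  assumes "prime p" "coprime m n" "p dvd c4 (tate_seven m n)"
  shows "\<not> p dvd m * n * (m - n)"
    and "p dvd tate_seven_cubic m n \<Longrightarrow> p = 7"
proof -
  let ?C = "c4 (tate_seven m n)"
  have not_both: "\<not> (p dvd m \<and> p dvd n)"
    using assms(1,2) by (meson coprime_common_divisor not_prime_unit)
  have dvd_power: "p dvd x ^ k \<Longrightarrow> p dvd x" for x k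
    using assms(1) prime_dvd_power by blast
  have m: "\<not> p dvd m"
  proof
    assume "p dvd m"
    moreover have "n^8 = ?C - m * (m^7 - 12 * m^6 * n + 42 * m^5 * n^2 - 56 * m^4 * n^3
        + 35 * m^3 * n^4 - 14 * m * n^6 + 4 * n^7)"
      unfolding c4_tate_seven by Groebner_Basis.algebra
    ultimately have "p dvd n^8" using assms(3) by simp
    then show False using \<open>p dvd m\<close> not_both dvd_power by blast
  qed
  have n: "\<not> p dvd n"
  proof
    assume "p dvd n"
    moreover have "m^8 = ?C - n * (- 12 * m^7 + 42 * m^6 * n - 56 * m^5 * n^2
        + 35 * m^4 * n^3 - 14 * m^2 * n^5 + 4 * m * n^6 + n^7)"
      unfolding c4_tate_seven by Groebner_Basis.algebra
    ultimately have "p dvd m^8" using assms(3) by simp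
    then show False using \<open>p dvd n\<close> not_both dvd_power by blast
  qed
  have mn: "\<not> p dvd m - n"
  proof
    assume "p dvd m - n"
    moreover have "n^8 = ?C - (m - n) * (m^7 - 11 * m^6 * n + 31 * m^5 * n^2 - 25 * m^4 * n^3
        + 10 * m^3 * n^4 + 10 * m^2 * n^5 - 4 * m * n^6)"
      unfolding c4_tate_seven by Groebner_Basis.algebra
    ultimately have "p dvd n^8" using assms(3) by simp
    then show False using n dvd_power by blast
  qed
  show "\<not> p dvd m * n * (m - n)"
    using m n mn assms(1) by (simp add: prime_dvd_mult_iff)
  show "p = 7" if "p dvd tate_seven_cubic m n"
  proof -
    \<comment> \<open>a Bezout identity from the extended Euclidean algorithm\<close>
    have "7^2 * n^10 = tate_seven_cubic m n * (- 1661 * n^7 - 1540 * m * n^6 + 6776 * m^2 * n^5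
        - 693 * m^3 * n^4 - 6853 * m^4 * n^3 + 12530 * m^5 * n^2 - 4781 * m^6 * n + 444 * m^7)
        + ?C * (1710 * n^2 + 3005 * m * n - 444 * m^2)"
      unfolding c4_tate_seven tate_seven_cubic_def by Groebner_Basis.algebra
    then have "p dvd 7^2 * n^10" using that assms(3) by simp
    then have "p dvd 7" using n dvd_power assms(1) prime_dvd_mult_iff by blast
    then show "p = 7" using assms(1) primes_dvd_imp_eq[of p 7] by simp
  qed
qed

text \<open>A prime dividing \<open>c4\<close> is prime to \<open>m * n * (m - n)\<close>, so its
  twelfth power would divide the cubic factor alone. This forces the prime 7, and \<open>7^3\<close>
  dividing the cubic forces 7 to divide \<open>n\<close>.\<close>

lemma tate_seven_minimal:
  assumes "prime (p::int)" "coprime m n" "p^12 dvd discriminant (tate_seven m n)"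
  shows "\<not> p dvd c4 (tate_seven m n)"
proof
  assume c4: "p dvd c4 (tate_seven m n)"
  note p = prime_dvd_c4_tate_seven[OF assms(1,2) c4]
  have "coprime (p^12) ((m * n * (m - n))^7)"
    using p(1) assms(1) by (intro coprime_power_left_iff[THEN iffD2] coprime_power_right_iff[THEN iffD2] disjI1 prime_imp_coprime)
  then have dvd: "p^12 dvd tate_seven_cubic m n"
    using assms(3) by (simp add: discriminant_tate_seven coprime_dvd_mult_right_iff)
  then have "p dvd tate_seven_cubic m n" using dvd_trans[of p "p^12"] by simp
  then have "p = 7" by (rule p(2))
  moreover from this have "7^3 dvd tate_seven_cubic m n"
    using dvd dvd_trans[OF le_imp_power_dvd[of 3 12 p]] by simp
  ultimately show False using tate_seven_cubic_seven_power p(1) by auto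
qed

text \<open>Write the scaling between the two models as \<open>h / k\<close> in lowest terms. A
  prime dividing \<open>k\<close> would contradict \<open>tate_seven_minimal\<close>, so
  \<open>k = 1\<close>; then the choice of \<open>M\<close> as a model of least discriminant gives
  \<open>h^12 = 1\<close>.\<close>

lemma minimal_discriminant_tate_seven:
  assumes E: "elliptic_curve E" and mn: "coprime m n" and T: "integral_model E (tate_seven m n)"
  shows "minimal_discriminant E = discriminant (tate_seven m n)"
proof -
  let ?T = "tate_seven m n"
  define M where "M = minimal_model E"
  have M: "integral_model E M" and le: "nat \<bar>discriminant M\<bar> \<le> nat \<bar>discriminant ?T\<bar>"
    unfolding M_def minimal_model_def
    using arg_min_nat_lemma[of "integral_model E", OF T, of "\<lambda>M. nat \<bar>discriminant M\<bar>"] T by auto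
  obtain u r s t where u: "change_of_variables u r s t E (map_weierstrass rat_of_int M)"
    using M unfolding integral_model_def isomorphic_def by blast
  obtain v r' s' t' where v: "change_of_variables v r' s' t' E (map_weierstrass rat_of_int ?T)"
    using T unfolding integral_model_def isomorphic_def by blast
  have nz: "u \<noteq> 0" "v \<noteq> 0" using u v by (simp_all add: change_of_variables_def)
  have uv: "u^12 * of_int (discriminant M) = v^12 * of_int (discriminant ?T)"
    "u^4 * of_int (c4 M) = v^4 * of_int (c4 ?T)"
    using change_of_variables_discriminant[OF u] change_of_variables_discriminant[OF v]
      change_of_variables_c4[OF u] change_of_variables_c4[OF v]
    by (simp_all add: map_discriminant map_c4)
  obtain h k where hk: "quotient_of (v / u) = (h, k)" by fastforce
  have k: "k > 0" "coprime h k" "v / u = of_int h / of_int k"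
    using hk quotient_of_denom_pos quotient_of_coprime quotient_of_div by blast+
  have v_eq: "v * of_int k = u * of_int h" using k nz by (simp add: field_simps)
  have "rat_of_int (k^12 * discriminant M) = of_int (h^12 * discriminant ?T)"
  proof -
    have "u^12 * rat_of_int (k^12 * discriminant M) = of_int k^12 * (u^12 * of_int (discriminant M))"
      by simp
    also have "\<dots> = (v * of_int k)^12 * of_int (discriminant ?T)"
      by (simp add: uv(1) power_mult_distrib)
    also have "\<dots> = u^12 * of_int (h^12 * discriminant ?T)"
      unfolding v_eq by (simp add: power_mult_distrib)
    finally show ?thesis using nz by simp
  qed
  then have disc: "k^12 * discriminant M = h^12 * discriminant ?T" by (simp only: of_int_eq_iff)
  have "rat_of_int (k^4 * c4 M) = of_int (h^4 * c4 ?T)"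
  proof -
    have "u^4 * rat_of_int (k^4 * c4 M) = of_int k^4 * (u^4 * of_int (c4 M))"
      by simp
    also have "\<dots> = (v * of_int k)^4 * of_int (c4 ?T)"
      by (simp add: uv(2) power_mult_distrib)
    also have "\<dots> = u^4 * of_int (h^4 * c4 ?T)"
      unfolding v_eq by (simp add: power_mult_distrib)
    finally show ?thesis using nz by simp
  qed
  then have c4: "k^4 * c4 M = h^4 * c4 ?T" by (simp only: of_int_eq_iff)
  have "coprime (k^i) (h^i)" for i using k(2) by (simp add: coprime_commute)
  then have dvd: "k^12 dvd discriminant ?T" "k^4 dvd c4 ?T"
    using disc c4 by (metis coprime_dvd_mult_right_iff dvd_triv_left)+
  have "k = 1"
  proof (rule ccontr)
    assume "k \<noteq> 1"
    then obtain p where p: "prime p" "p dvd k"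
      using k(1) prime_divisor_exists[of k] by auto
    then have "p^12 dvd k^12" "p dvd k^4" by (simp_all add: dvd_power_same prime_dvd_power_iff)
    then show False using tate_seven_minimal[OF p(1) mn] dvd dvd_trans by blast
  qed
  with disc have disc': "discriminant M = h^12 * discriminant ?T" by simp
  have "discriminant M \<noteq> 0"
    using E change_of_variables_discriminant[OF u] unfolding elliptic_curve_def
    by (auto simp: map_discriminant)
  then have T0: "discriminant ?T \<noteq> 0" "h \<noteq> 0" using disc' by auto
  have "\<bar>h^12\<bar> * \<bar>discriminant ?T\<bar> \<le> 1 * \<bar>discriminant ?T\<bar>"
    using le by (simp add: disc' abs_mult)
  then have "\<bar>h^12\<bar> \<le> 1" using T0 mult_le_cancel_right by (metis abs_not_less_zero abs_eq_0 linorder_neqE)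
  moreover have "h^12 > 0" using T0 by simp
  ultimately have "h^12 = 1" by linarith
  then show ?thesis using disc' by (simp add: minimal_discriminant_def M_def)
qed

section \<open>Primes dividing the conductor\<close>

text \<open>Bad reduction is multiplicative or additive by definition, so every bad prime has a
  positive exponent in the product.\<close>

lemma prime_dvd_conductor_iff:
  assumes "minimal_discriminant E \<noteq> 0" "prime l"
  shows "l dvd conductor E \<longleftrightarrow> int l dvd minimal_discriminant E"
proof -
  \<comment> \<open>Finiteness matters: a product over an infinite set is 1 by convention.\<close>
  have "{p. prime p \<and> bad_reduction E p} \<subseteq> {..nat \<bar>minimal_discriminant E\<bar>}"
    using assms(1) by (auto simp: bad_reduction_def dest!: dvd_imp_le_int)
  then have "finite {p. prime p \<and> bad_reduction E p}" using finite_subset by blast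
  moreover have "conductor_exponent E p > 0" if "bad_reduction E p" for p
    using that by (auto simp: conductor_exponent_def additive_reduction_def)
  ultimately show ?thesis
    using assms(2) unfolding conductor_def bad_reduction_def[symmetric]
    by (auto simp: prime_dvd_prod_iff prime_dvd_power_iff dest: primes_dvd_imp_eq)
qed

section \<open>Two bad primes\<close>

text \<open>44 is 2 modulo 3 and 57 is 2 modulo 5, both non-residues. They are the discriminants of
  the quadratic cofactors below.\<close>

lemma int_square_not_44_57: "(x::int)^2 \<noteq> 44" "(x::int)^2 \<noteq> 57"
proof -
  have "x^2 mod 3 = (x mod 3)^2 mod 3" "x^2 mod 5 = (x mod 5)^2 mod 5"
    by (simp_all add: power_mod)
  moreover have "x mod 3 \<in> {0,1,2}" "x mod 5 \<in> {0,1,2,3,4}" by auto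
  ultimately show "(x::int)^2 \<noteq> 44" "(x::int)^2 \<noteq> 57" by auto
qed

lemma tate_seven_cubic_uminus: "tate_seven_cubic (- m) (- n) = - tate_seven_cubic m n"
  by (simp add: tate_seven_cubic_def)

lemma quadratic_no_int_root:
  fixes x a b :: int
  assumes "a^2 - 4 * b \<in> {44, 57}"
  shows "x^2 + a * x + b \<noteq> 0"
proof
  assume "x^2 + a * x + b = 0"
  then have "(2 * x + a)^2 = a^2 - 4 * b" by Groebner_Basis.algebra
  then show False using assms int_square_not_44_57 by auto
qed

text \<open>Once \<open>m\<close>, \<open>n\<close> or \<open>m - n\<close> is 1, each of the
  equations \<open>F = 1\<close> and \<open>F = -1\<close> for the cubic has a root with
  \<open>m * n * (m - n) = 0\<close> and a quadratic cofactor without integer roots. Oddness of the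
  cubic reduces the value -1 to 1.\<close>

lemma tate_seven_cubic_eq_1_or_uminus_1:
  assumes F: "\<bar>tate_seven_cubic m n\<bar> = 1" and "\<bar>m\<bar> = 1 \<or> \<bar>n\<bar> = 1 \<or> \<bar>m - n\<bar> = 1"
  shows "m * n * (m - n) = 0"
proof -
  have n1: "x * 1 * (x - 1) = 0" if "\<bar>tate_seven_cubic x 1\<bar> = 1" for x
  proof -
    have "x * (x^2 + (-8) * x + 5) = tate_seven_cubic x 1 - 1"
      "(x - 1) * (x^2 + (-7) * x + (-2)) = tate_seven_cubic x 1 + 1"
      by (simp_all add: tate_seven_cubic_def algebra_simps power_numeral_reduce)
    moreover have "x^2 + (-8) * x + 5 \<noteq> 0" "x^2 + (-7) * x + (-2) \<noteq> 0"
      by (rule quadratic_no_int_root, simp)+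
    ultimately show ?thesis using that by (auto simp: abs_if split: if_splits)
  qed
  have m1: "1 * x * (1 - x) = 0" if "\<bar>tate_seven_cubic 1 x\<bar> = 1" for x
  proof -
    have "x * (x^2 + 5 * x + (-8)) = tate_seven_cubic 1 x - 1"
      "(x - 1) * (x^2 + 6 * x + (-2)) = tate_seven_cubic 1 x + 1"
      by (simp_all add: tate_seven_cubic_def algebra_simps power_numeral_reduce)
    moreover have "x^2 + 5 * x + (-8) \<noteq> 0" "x^2 + 6 * x + (-2) \<noteq> 0"
      by (rule quadratic_no_int_root, simp)+
    ultimately show ?thesis using that by (auto simp: abs_if split: if_splits)
  qed
  have mn1: "(x + 1) * x * ((x + 1) - x) = 0" if "\<bar>tate_seven_cubic (x + 1) x\<bar> = 1" for x
  proof -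
    have "- x * (x^2 + 8 * x + 5) = tate_seven_cubic (x + 1) x - 1"
      "- (x + 1) * (x^2 + 7 * x + (-2)) = tate_seven_cubic (x + 1) x + 1"
      unfolding tate_seven_cubic_def by Groebner_Basis.algebra+
    moreover have "x^2 + 8 * x + 5 \<noteq> 0" "x^2 + 7 * x + (-2) \<noteq> 0"
      by (rule quadratic_no_int_root, simp)+
    ultimately show ?thesis using that by (auto simp: abs_if split: if_splits)
  qed
  have F': "\<bar>tate_seven_cubic (- m) (- n)\<bar> = 1" using F by (simp add: tate_seven_cubic_uminus)
  consider "m = 1" | "- m = 1" | "n = 1" | "- n = 1" | "m = n + 1" | "- m = - n + 1"
    using assms(2) by linarith
  then show ?thesis
  proof cases
    case 1 then show ?thesis using m1 F by simp
  next
    case 2 then show ?thesis using m1[of "- n"] F' by (auto simp: add_eq_0_iff)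
  next
    case 3 then show ?thesis using n1 F by simp
  next
    case 4 then show ?thesis using n1[of "- m"] F' by auto
  next
    case 5 then show ?thesis using mn1 F by simp
  next
    case 6 then show ?thesis using mn1[of "- n"] F' by auto
  qed
qed

lemma is_unit_if_no_prime_dvd:
  fixes x :: int
  assumes "x \<noteq> 0" "\<And>l. prime l \<Longrightarrow> \<not> l dvd x"
  shows "\<bar>x\<bar> = 1"
  using prime_divisor_exists[of x] assms by auto

lemma discriminant_tate_seven_two_primes:
  assumes "coprime m n" and D: "discriminant (tate_seven m n) \<noteq> 0"
    and primes: "\<And>l. prime l \<Longrightarrow> l dvd discriminant (tate_seven m n) \<Longrightarrow> l = p \<or> l = q"
  shows "discriminant (tate_seven m n) = - (2^7 * 13)"
proof -
  define F where "F = tate_seven_cubic m n"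
  have D_eq: "discriminant (tate_seven m n) = (m * n * (m - n))^7 * F"
    by (simp add: discriminant_tate_seven F_def)
  have nz: "m \<noteq> 0" "n \<noteq> 0" "m - n \<noteq> 0" "F \<noteq> 0" using D unfolding D_eq by auto
  have not_both: "\<not> (l dvd m \<and> l dvd n)" if "prime l" for l
    using that assms(1) by (meson coprime_common_divisor not_prime_unit)
  then have disj: "\<not> (l dvd m \<and> l dvd m - n)" "\<not> (l dvd n \<and> l dvd m - n)" if "prime l" for l
    using that by (metis dvd_diff_right_iff dvd_diff_left_iff)+
  \<comment> \<open>The cubic is \<open>n^3\<close> modulo \<open>m\<close>, \<open>m^3\<close>
    modulo \<open>n\<close> and \<open>- n^3\<close> modulo \<open>m - n\<close>.\<close>
  have dvd_F: "\<not> l dvd m * n * (m - n)" if l: "prime l" "l dvd F" for l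
  proof
    assume "l dvd m * n * (m - n)"
    then consider "l dvd m" | "l dvd n" | "l dvd m - n" using l(1) by (auto simp: prime_dvd_mult_iff)
    then show False
    proof cases
      case 1
      moreover have "n^3 = F - m * (m^2 - 8 * m * n + 5 * n^2)"
        unfolding F_def tate_seven_cubic_def by Groebner_Basis.algebra
      ultimately have "l dvd n^3" using l by simp
      then show False using 1 not_both l prime_dvd_power by blast
    next
      case 2
      moreover have "m^3 = F - n * (- 8 * m^2 + 5 * m * n + n^2)"
        unfolding F_def tate_seven_cubic_def by Groebner_Basis.algebra
      ultimately have "l dvd m^3" using l by simp
      then show False using 2 not_both l prime_dvd_power by blast
    next
      case 3
      moreover have "n^3 = (m - n) * (m^2 - 7 * m * n - 2 * n^2) - F"
        unfolding F_def tate_seven_cubic_def by Groebner_Basis.algebra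
      ultimately have "l dvd n^3" using l by simp
      then show False using 3 disj(2) l prime_dvd_power by blast
    qed
  qed
  have two: "2 dvd m * n * (m - n)" by simp blast
  then have "2 dvd discriminant (tate_seven m n)"
    unfolding D_eq by simp
  then have "2 = p \<or> 2 = q" using primes[of 2] by simp
  \<comment> \<open>\<open>r\<close> is the one of \<open>p\<close>, \<open>q\<close> that may
    differ from 2.\<close>
  then obtain r where r: "\<And>l. prime l \<Longrightarrow> l dvd discriminant (tate_seven m n) \<Longrightarrow> l = 2 \<or> l = r"
    using primes by blast
  have dvd_D: "l dvd discriminant (tate_seven m n)" if "l dvd m * n * (m - n) \<or> l dvd F" for l
    using that
  proof
    assume "l dvd m * n * (m - n)"
    moreover have "m * n * (m - n) dvd (m * n * (m - n))^7" by (rule dvd_power) simp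
    ultimately show ?thesis unfolding D_eq by (intro dvd_mult2) (rule dvd_trans)
  next
    assume "l dvd F"
    then show ?thesis unfolding D_eq by (rule dvd_mult)
  qed
  show ?thesis
  proof (cases "r dvd m * n * (m - n)")
    case True
    \<comment> \<open>Both candidates 2 and \<open>r\<close> divide \<open>m * n * (m - n)\<close>,
      which is prime to \<open>F\<close>.\<close>
    have "\<not> l dvd F" if "prime l" for l
    proof
      assume "l dvd F"
      then have "l dvd discriminant (tate_seven m n)" by (intro dvd_D disjI2)
      from r[OF that this] have "l dvd m * n * (m - n)" using True two by (elim disjE) simp_all
      with dvd_F[OF that \<open>l dvd F\<close>] show False ..
    qed
    then have "\<bar>tate_seven_cubic m n\<bar> = 1" using is_unit_if_no_prime_dvd[OF nz(4)] by (simp add: F_def)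
    moreover have "\<bar>m\<bar> = 1 \<or> \<bar>n\<bar> = 1 \<or> \<bar>m - n\<bar> = 1"
    proof (rule ccontr)
      assume "\<not> ?thesis"
      then obtain l1 l2 l3 where "prime l1" "l1 dvd m" "prime l2" "l2 dvd n" "prime l3" "l3 dvd m - n"
        using is_unit_if_no_prime_dvd[OF nz(1)] is_unit_if_no_prime_dvd[OF nz(2)]
          is_unit_if_no_prime_dvd[OF nz(3)] by blast
      \<comment> \<open>Two of three primes chosen among 2 and \<open>r\<close> coincide, against
        pairwise coprimality.\<close>
      moreover from this have "l1 = 2 \<or> l1 = r" "l2 = 2 \<or> l2 = r" "l3 = 2 \<or> l3 = r"
        using r dvd_D by (meson dvd_mult dvd_mult2)+
      ultimately show False using not_both disj by metis
    qed
    ultimately have "m * n * (m - n) = 0" by (rule tate_seven_cubic_eq_1_or_uminus_1)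
    then show ?thesis using nz by simp
  next
    case False
    \<comment> \<open>Only 2 is left as a prime divisor of \<open>m * n * (m - n)\<close>.\<close>
    have pow2: "\<bar>x\<bar> = 1" if "odd x" "x dvd m * n * (m - n)" "x \<noteq> 0" for x
    proof (rule is_unit_if_no_prime_dvd)
      fix l :: int assume l: "prime l"
      show "\<not> l dvd x"
      proof
        assume "l dvd x"
        then have *: "l dvd m * n * (m - n)" using that(2) by (rule dvd_trans)
        then have "l dvd discriminant (tate_seven m n)" by (intro dvd_D disjI1)
        from r[OF l this] show False using * False \<open>l dvd x\<close> \<open>odd x\<close> by (elim disjE) simp_all
      qed
    qed fact
    \<comment> \<open>Exactly one of \<open>m\<close>, \<open>n\<close>, \<open>m - n\<close> is
      even. The other two are units, and being nonzero the even one is 2 or -2.\<close>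
    have "m \<in> {1,-1} \<and> n = - m \<or> m \<in> {1,-1} \<and> n = 2 * m \<or> n \<in> {1,-1} \<and> m = 2 * n"
    proof (cases "even m")
      case True
      then have "odd n" using not_both[of 2] by auto
      then have "\<bar>n\<bar> = 1" "\<bar>m - n\<bar> = 1" using pow2[of n] pow2[of "m - n"] nz True by auto
      then show ?thesis using nz by (auto simp: abs_if split: if_splits)
    next
      case m: False
      then have m1: "\<bar>m\<bar> = 1" using pow2[of m] nz by auto
      show ?thesis
      proof (cases "even n")
        case True
        then have "\<bar>m - n\<bar> = 1" using pow2[of "m - n"] nz m by auto
        then show ?thesis using nz m1 by (auto simp: abs_if split: if_splits)
      next
        case False
        then have "\<bar>n\<bar> = 1" using pow2[of n] nz by auto
        then show ?thesis using nz m1 by (auto simp: abs_if split: if_splits)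
      qed
    qed
    \<comment> \<open>In all six cases \<open>m * n * (m - n)\<close> and \<open>F\<close> have
      absolute values 2 and 13 and opposite signs.\<close>
    then show ?thesis unfolding D_eq F_def tate_seven_cubic_def by auto
  qed
qed

lemma seven_torsion_two_primes:
  assumes "elliptic_curve E" "torsion E 7 \<noteq> {Infinity}"
    and pq: "prime p" "prime q" "p \<noteq> q" "\<alpha> > 0" "\<beta> > 0" "conductor E = p^\<alpha> * q^\<beta>"
  shows "minimal_discriminant E = - (2^7 * 13)" and "26 \<le> conductor E"
proof -
  obtain m n where mn: "coprime m n" "integral_model E (tate_seven m n)"
    using integral_model_tate_seven assms(1,2) by blast
  have D: "minimal_discriminant E = discriminant (tate_seven m n)"
    by (rule minimal_discriminant_tate_seven) fact+
  obtain u r s t where "change_of_variables u r s t E (map_weierstrass rat_of_int (tate_seven m n))"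
    using mn unfolding integral_model_def isomorphic_def by blast
  from change_of_variables_discriminant[OF this] have nz: "minimal_discriminant E \<noteq> 0"
    using assms(1) unfolding D by (auto simp: map_discriminant elliptic_curve_def)
  have primes: "l = p \<or> l = q" if "prime l" "int l dvd minimal_discriminant E" for l
  proof -
    have "l dvd p^\<alpha> * q^\<beta>" using prime_dvd_conductor_iff[OF nz that(1)] that(2) pq(6) by simp
    then have "l dvd p \<or> l dvd q" using that(1) prime_dvd_mult_iff prime_dvd_power by blast
    then show ?thesis using that(1) pq(1,2) primes_dvd_imp_eq by blast
  qed
  show *: "minimal_discriminant E = - (2^7 * 13)"
    unfolding D
  proof (rule discriminant_tate_seven_two_primes[OF mn(1)])
    fix l :: int assume l: "prime l" "l dvd discriminant (tate_seven m n)"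
    then have "prime (nat l)" "l = int (nat l)" by (simp_all add: prime_ge_0_int)
    then show "l = int p \<or> l = int q" using primes[of "nat l"] l(2) unfolding D by metis
  qed (use nz D in simp)
  \<comment> \<open>Both primes of the discriminant divide the conductor, which bounds it
    below.\<close>
  have "2 dvd conductor E" "13 dvd conductor E"
    using prime_dvd_conductor_iff[OF nz, of 2] prime_dvd_conductor_iff[OF nz, of 13] *
    by (simp_all add: prime_nat_numeral_eq)
  then have "26 dvd conductor E" by presburger
  moreover have "conductor E > 0" using pq by (simp add: prime_gt_0_nat)
  ultimately show "26 \<le> conductor E" using dvd_imp_le by fastforce
qed

theorem theorem3p6:
  shows "(\<forall>(E :: rat weierstrass) (p :: nat) (q :: nat) (\<alpha> :: nat) (\<beta> :: nat).
            elliptic_curve E \<and> torsion E 7 \<noteq> {Infinity} \<and>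
            prime p \<and> prime q \<and> p \<noteq> q \<and> \<alpha> > 0 \<and> \<beta> > 0 \<and> conductor E = p ^ \<alpha> * q ^ \<beta> \<longrightarrow>
              minimal_discriminant E = - (2 ^ 7 * 13) \<and>
              \<bar>minimal_discriminant E\<bar> < int (conductor E) ^ 3) \<and>
         (\<forall>\<epsilon> :: real. \<epsilon> > 0 \<longrightarrow> (\<exists>C :: real. \<forall>E :: rat weierstrass.
            elliptic_curve E \<and> torsion E 7 \<noteq> {Infinity} \<and>
            (\<exists>(p :: nat) (q :: nat) (\<alpha> :: nat) (\<beta> :: nat).
               prime p \<and> prime q \<and> p \<noteq> q \<and> \<alpha> > 0 \<and> \<beta> > 0 \<and> conductor E = p ^ \<alpha> * q ^ \<beta>) \<longrightarrow>
              real_of_int \<bar>minimal_discriminant E\<bar> \<le> C * real (conductor E) powr (6 + \<epsilon>)))"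
proof (intro conjI allI impI)
  fix E :: "rat weierstrass" and p q \<alpha> \<beta> :: nat
  assume "elliptic_curve E \<and> torsion E 7 \<noteq> {Infinity} \<and>
    prime p \<and> prime q \<and> p \<noteq> q \<and> \<alpha> > 0 \<and> \<beta> > 0 \<and> conductor E = p ^ \<alpha> * q ^ \<beta>"
  then have *: "minimal_discriminant E = - (2 ^ 7 * 13)" "26 \<le> conductor E"
    using seven_torsion_two_primes by blast+
  then show "minimal_discriminant E = - (2 ^ 7 * 13)" by blast
  \<comment> \<open>\<open>26^3 = 17576\<close> exceeds \<open>2^7 * 13 = 1664\<close>.\<close>
  have "(26::int)^3 \<le> int (conductor E) ^ 3" using *(2) by (intro power_mono) simp_all
  then show "\<bar>minimal_discriminant E\<bar> < int (conductor E) ^ 3" using *(1) by simp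
next
  fix \<epsilon> :: real assume "\<epsilon> > 0"
  show "\<exists>C :: real. \<forall>E :: rat weierstrass.
            elliptic_curve E \<and> torsion E 7 \<noteq> {Infinity} \<and>
            (\<exists>(p :: nat) (q :: nat) (\<alpha> :: nat) (\<beta> :: nat).
               prime p \<and> prime q \<and> p \<noteq> q \<and> \<alpha> > 0 \<and> \<beta> > 0 \<and> conductor E = p ^ \<alpha> * q ^ \<beta>) \<longrightarrow>
              real_of_int \<bar>minimal_discriminant E\<bar> \<le> C * real (conductor E) powr (6 + \<epsilon>)"
  proof (intro exI allI impI, elim conjE exE)
    fix E :: "rat weierstrass" and p q \<alpha> \<beta> :: nat
    assume "elliptic_curve E" "torsion E 7 \<noteq> {Infinity}"
      "prime p" "prime q" "p \<noteq> q" "\<alpha> > 0" "\<beta> > 0" "conductor E = p ^ \<alpha> * q ^ \<beta>"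
    then have *: "minimal_discriminant E = - (2 ^ 7 * 13)" "26 \<le> conductor E"
      using seven_torsion_two_primes by blast+
    then have "1 \<le> real (conductor E) powr (6 + \<epsilon>)"
      using \<open>\<epsilon> > 0\<close> by (intro ge_one_powr_ge_zero) simp_all
    \<comment> \<open>The discriminant is constant on the family, so its absolute value 1664 serves
      as the constant for every \<epsilon>.\<close>
    then show "real_of_int \<bar>minimal_discriminant E\<bar> \<le> 1664 * real (conductor E) powr (6 + \<epsilon>)"
      using *(1) by simp
  qed
qed

end
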